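(* Let $\mathcal{A}$ be the $n$-dimensional null-filiform associative algebra over $\mathbb{C}$ with basis $e_1,\dots,e_n$, and let $P_1$ be a (homogeneous) Average operator with degree $1$ on $\mathcal{A}$, with associated function $\psi$. Then: (a) If $\psi(1)\psi(2)\neq 0$, then $P_1(e_i)=\psi(1)e_{i+1}$; (b) If $\psi(1)\ne 0$ and $\psi(2)=0$, then \[P_1(e_i)=\begin{cases}\psi(1)e_{i+1}, & i\ \text{odd},\\ 0,&\text{otherwise;}\end{cases}\] (c) If $\psi(1)=0$ and $\psi(t)\ne 0$ for some $2\le t\le\lfloor (n-2)/2\rfloor$, then \[P_1(e_i)=\begin{cases}\psi(t)e_{i+1}, & i+1\equiv 0\ (\bmod\ t+1),\\ 0,&\text{otherwise;}\end{cases}\] (d) If $\psi(t)=0$ for all $1\le t\le\lfloor (n-2)/2\rfloor$, then \[P_1(e_i)=\begin{cases}\psi(r)e_{r+1}, & i=r,\\ \psi(r+1)e_{r+2}, & i=r+1,\\ 0,&\text{otherwise,}\end{cases}\] for some fixed $\lfloor (n-2)/2\rfloor<r\le n-1$.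
   Context: The $n$-dimensional null-filiform associative algebra $\mathcal{A}$ over $\mathbb{C}$ has basis $e_1,\dots,e_n$ and bilinear product $e_ie_j=e_{i+j}$ if $i+j\le n$, and $e_ie_j=0$ otherwise; the symbol $e_m$ with $m>n$ is read as $0$. A homogeneous operator of degree $1$ on $\mathcal{A}$ is a linear map $P_1$ with $P_1(e_i)=\psi(i)e_{i+1}$ for $1\le i\le n-1$ and $P_1(e_n)=\psi(n)e_1$, where $\psi:\mathbb{N}\to\mathbb{C}$ is a function. An Average operator is a linear map $P:\mathcal{A}\to\mathcal{A}$ with $P(x)P(y)=P(xP(y))$ for all $x,y\in\mathcal{A}$.
   Formalization: The formal version takes n ≥ 2, excludes n = 3 and n = 4 in (a), and in (c) asserts the formula for the least t with ψ(t) ≠ 0 (not for an arbitrary such t), since the printed statement has counterexamples in the excluded cases. *)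

theory Defs
  imports Complex_Main "HOL-Number_Theory.Cong"
begin

text \<open>
  The ground type \<open>'a\<close> is the whole algebra; the base vectors are numbered \<open>e 1, \<dots>, e n\<close>
  as in the usual presentation, and \<open>e m\<close> denotes \<open>0\<close> for \<open>m > n\<close>. The value \<open>e 0\<close> is
  unconstrained and irrelevant. Associativity is not assumed: it follows from bilinearity and
  the multiplication table.
\<close>

locale null_filiform_algebra =
  finite_dimensional_vector_space scale "e ` {1..n}"
  for scale :: "complex \<Rightarrow> 'a::ab_group_add \<Rightarrow> 'a" (infixr \<open>*s\<close> 75)
    and prd :: "'a \<Rightarrow> 'a \<Rightarrow> 'a" (infixl \<open>\<cdot>\<close> 70)
    and e :: "nat \<Rightarrow> 'a"
    and n :: nat +
  assumes inj_on_e: "inj_on e {1..n}"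
    and e_beyond: "\<And>m. n < m \<Longrightarrow> e m = 0"
    and linear_prd_left: "\<And>y. Vector_Spaces.linear scale scale (\<lambda>x. x \<cdot> y)"
    and linear_prd_right: "\<And>x. Vector_Spaces.linear scale scale (\<lambda>y. x \<cdot> y)"
    and prd_e: "\<And>i j. i \<in> {1..n} \<Longrightarrow> j \<in> {1..n} \<Longrightarrow>
                  e i \<cdot> e j = (if i + j \<le> n then e (i + j) else 0)"

definition homogeneous_operator_degree_1 ::
  "(complex \<Rightarrow> 'a::ab_group_add \<Rightarrow> 'a) \<Rightarrow> (nat \<Rightarrow> 'a) \<Rightarrow> nat \<Rightarrow> (nat \<Rightarrow> complex) \<Rightarrow> ('a \<Rightarrow> 'a) \<Rightarrow> bool"
where
  "homogeneous_operator_degree_1 scale e n \<psi> P \<longleftrightarrow>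
     Vector_Spaces.linear scale scale P \<and>
     (\<forall>i. 1 \<le> i \<and> i \<le> n - 1 \<longrightarrow> P (e i) = scale (\<psi> i) (e (i + 1))) \<and>
     P (e n) = scale (\<psi> n) (e 1)"

definition average_operator ::
  "(complex \<Rightarrow> 'a::ab_group_add \<Rightarrow> 'a) \<Rightarrow> ('a \<Rightarrow> 'a \<Rightarrow> 'a) \<Rightarrow> ('a \<Rightarrow> 'a) \<Rightarrow> bool"
where
  "average_operator scale prd P \<longleftrightarrow>
     Vector_Spaces.linear scale scale P \<and>
     (\<forall>x y. prd (P x) (P y) = P (prd x (P y)))"

end

theory Submission
  imports Defs
begin

text \<open>
  Comparing coefficients in \<open>P(e\<^sub>i) P(e\<^sub>j) = P(e\<^sub>i P(e\<^sub>j))\<close> shows that \<open>\<psi>(n) = 0\<close> (from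
  \<open>i = n - 1\<close>, \<open>j = n\<close>) and that, for \<open>i + j \<le> n - 2\<close>, either \<open>\<psi>(j) = 0\<close> or
  \<open>\<psi>(i + j + 1) = \<psi>(i)\<close>. So every \<open>t\<close> with \<open>\<psi>(t) \<noteq> 0\<close> makes \<open>\<psi>\<close> periodic with period
  \<open>t + 1\<close> on \<open>1, \<dots>, n - 1\<close>, and the cases come from
  applying this to the least such \<open>t\<close> and, if \<open>\<psi>(t + 1) \<noteq> 0\<close>, to \<open>t + 1\<close> as well.
\<close>

section \<open>Identities for the coefficients of an average operator\<close>

context null_filiform_algebra
begin

lemma e_nonzero:
  assumes "i \<in> {1..n}"
  shows "e i \<noteq> 0"
  using assms independent_Basis dependent_zero by (metis imageI)

lemma scale_prd_left: "(c *s x) \<cdot> y = c *s (x \<cdot> y)"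
  using linear_prd_left[of y] module_hom.scale[of scale scale "\<lambda>x. x \<cdot> y" c x]
  by (simp add: linear_iff_module_hom)

lemma scale_prd_right: "x \<cdot> (c *s y) = c *s (x \<cdot> y)"
  using linear_prd_right[of x] by (simp add: linear_iff_module_hom module_hom.scale)

context
  fixes P :: "'a \<Rightarrow> 'a" and \<psi> :: "nat \<Rightarrow> complex"
  assumes hom: "homogeneous_operator_degree_1 scale e n \<psi> P"
    and avg: "average_operator scale prd P"
begin

lemma P_scale: "P (c *s x) = c *s P x"
  using avg by (simp add: average_operator_def linear_iff_module_hom module_hom.scale)

lemma P_e:
  assumes "1 \<le> i" "i \<le> n - 1"
  shows "P (e i) = \<psi> i *s e (i + 1)"
  using hom assms unfolding homogeneous_operator_degree_1_def by blast

lemma P_e_n: "P (e n) = \<psi> n *s e 1"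
  using hom unfolding homogeneous_operator_degree_1_def by blast

lemma P_prd: "P x \<cdot> P y = P (x \<cdot> P y)"
  using avg unfolding average_operator_def by blast

text \<open>\<open>P (e (n - 1)) \<cdot> P (e n)\<close> would have index \<open>n + 1\<close>, so
  it vanishes. On the other side \<open>e (n - 1) \<cdot> e 1 = e n\<close>, and applying
  \<open>P\<close> to it brings out a second factor \<open>\<psi> n\<close>.\<close>

lemma average_last_coefficient:
  assumes "2 \<le> n"
  shows "\<psi> n = 0"
proof -
  have "P (e (n - 1)) = \<psi> (n - 1) *s e n"
    using P_e[of "n - 1"] assms by simp
  then have "P (e (n - 1)) \<cdot> P (e n) = 0"
    using assms by (simp add: P_e_n scale_prd_left scale_prd_right prd_e)
  moreover have "P (e (n - 1) \<cdot> P (e n)) = (\<psi> n * \<psi> n) *s e 1"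
    using assms by (simp add: P_e_n P_scale scale_prd_right prd_e)
  ultimately have "(\<psi> n * \<psi> n) *s e 1 = 0"
    by (simp add: P_prd)
  then show ?thesis
    using e_nonzero[of 1] assms by simp
qed

text \<open>At \<open>i = n\<close> both sides are zero, so the wrap-around to \<open>e 1\<close>
  needs no separate case later.\<close>

lemma P_e':
  assumes "2 \<le> n" "i \<in> {1..n}"
  shows "P (e i) = \<psi> i *s e (i + 1)"
  using assms P_e[of i] P_e_n average_last_coefficient by (cases "i = n") auto

text \<open>The bound on \<open>i + j\<close> keeps \<open>e (i + j + 2)\<close> nonzero, so its
  coefficients can be compared and \<open>\<psi> j\<close> cancelled.\<close>

lemma average_coefficient:
  assumes "1 \<le> i" "1 \<le> j" "i + j + 2 \<le> n" "\<psi> j \<noteq> 0"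
  shows "\<psi> (i + j + 1) = \<psi> i"
proof -
  have "P (e i) \<cdot> P (e j) = (\<psi> i * \<psi> j) *s e (i + j + 2)"
    using assms by (simp add: P_e scale_prd_left scale_prd_right prd_e)
  moreover have "P (e i \<cdot> P (e j)) = (\<psi> j * \<psi> (i + j + 1)) *s e (i + j + 2)"
    using assms P_e[of "i + j + 1"] by (simp add: P_e P_scale scale_prd_right prd_e)
  ultimately have "(\<psi> i * \<psi> j) *s e (i + j + 2) = (\<psi> j * \<psi> (i + j + 1)) *s e (i + j + 2)"
    by (metis P_prd)
  then show ?thesis
    using e_nonzero[of "i + j + 2"] assms by (auto simp del: add_2_eq_Suc')
qed

end

end

section \<open>Functions on the naturals with the periodicity relation\<close>

context
  fixes \<psi> :: "nat \<Rightarrow> complex" and n :: nat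
  assumes periodic: "\<And>i j. 1 \<le> i \<Longrightarrow> 1 \<le> j \<Longrightarrow> i + j + 2 \<le> n \<Longrightarrow> \<psi> j \<noteq> 0 \<Longrightarrow> \<psi> (i + j + 1) = \<psi> i"
begin

lemma coefficients_parity:
  assumes "\<psi> 1 \<noteq> 0" "1 \<le> i" "i < n"
  shows "\<psi> i = (if odd i then \<psi> 1 else \<psi> 2)"
  using assms(2,3)
proof (induction i rule: less_induct)
  case (less i)
  show ?case
  proof (cases "i \<le> 2")
    case True
    then have "i = 1 \<or> i = 2" using less.prems by auto
    then show ?thesis by auto
  next
    case False
    then have "i - 2 + 1 + 1 = i" by simp
    then have "\<psi> i = \<psi> (i - 2)"
      using periodic[of "i - 2" 1] less.prems assms(1) False by simp
    then show ?thesis using less.IH[of "i - 2"] less.prems False by simp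
  qed
qed

text \<open>The periods 2 and 3 are coprime: \<open>\<psi> 4\<close> equals \<open>\<psi> 1\<close>
  by the latter and \<open>\<psi> 2\<close> by the former.\<close>

lemma coefficients_constant:
  assumes "\<psi> 1 \<noteq> 0" "\<psi> 2 \<noteq> 0" "5 \<le> n" "1 \<le> i" "i < n"
  shows "\<psi> i = \<psi> 1"
proof -
  have "\<psi> 4 = \<psi> 1" using periodic[of 1 2] assms by (simp add: eval_nat_numeral)
  moreover have "\<psi> 4 = \<psi> 2" using coefficients_parity[of 4] assms by simp
  ultimately show ?thesis using coefficients_parity[of i] assms by simp
qed

text \<open>Otherwise both \<open>t + 1\<close> and \<open>t + 2\<close> are periods. Going back
  from \<open>2 * t + 1\<close> by each of them would give
  \<open>\<psi> t = \<psi> (t - 1) = 0\<close>.\<close>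

lemma coefficients_after_least:
  assumes "2 \<le> t" "2 * t + 2 \<le> n" "\<psi> t \<noteq> 0" and least: "\<And>s. 1 \<le> s \<Longrightarrow> s < t \<Longrightarrow> \<psi> s = 0"
  shows "\<psi> (t + 1) = 0"
proof (rule ccontr)
  assume "\<psi> (t + 1) \<noteq> 0"
  then have "\<psi> (2 * t + 1) = \<psi> (t - 1)"
    using periodic[of "t - 1" "t + 1"] assms(1,2) by (simp add: mult_2)
  moreover have "\<psi> (2 * t + 1) = \<psi> t"
    using periodic[of t t] assms(1-3) by (simp add: mult_2)
  moreover have "\<psi> (t - 1) = 0" using least assms(1) by simp
  ultimately show False using assms(3) by simp
qed

text \<open>On the first period \<open>1, \<dots>, t + 1\<close> only \<open>\<psi> t\<close> is
  nonzero; further indices are reduced by \<open>t + 1\<close>.\<close>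

lemma coefficients_mod:
  assumes "2 \<le> t" "2 * t + 2 \<le> n" "\<psi> t \<noteq> 0" and least: "\<And>s. 1 \<le> s \<Longrightarrow> s < t \<Longrightarrow> \<psi> s = 0"
    and "1 \<le> i" "i < n"
  shows "\<psi> i = (if (t + 1) dvd (i + 1) then \<psi> t else 0)"
  using assms(5,6)
proof (induction i rule: less_induct)
  case (less i)
  consider "i < t" | "i = t" | "i = t + 1" | "t + 1 < i" by linarith
  then show ?case
  proof cases
    case 1
    then show ?thesis using least less.prems by (auto dest: dvd_imp_le)
  next
    case 2
    then show ?thesis by simp
  next
    case 3
    have "\<not> (t + 1) dvd (t + 1) + 1"
      using assms(1) by (subst dvd_add_right_iff) auto
    then show ?thesis
      using 3 coefficients_after_least[OF assms(1-3) least] by simp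
  next
    case 4
    define k where "k = i - (t + 1)"
    have i: "i = k + t + 1" and k: "1 \<le> k" using 4 by (auto simp: k_def)
    have "\<psi> i = \<psi> k"
      using periodic[of k t] k i less.prems assms(1,3) by simp
    moreover have "(t + 1) dvd (i + 1) \<longleftrightarrow> (t + 1) dvd (k + 1)"
      using dvd_add_left_iff[of "t + 1" "t + 1" "k + 1"] by (simp add: i add.commute add.left_commute)
    ultimately show ?thesis using less.IH[of k] i k less.prems by simp
  qed
qed

text \<open>Let \<open>r\<close> be the least index below \<open>n\<close> with
  \<open>\<psi> r \<noteq> 0\<close>. Going back by \<open>r + 1\<close> from
  \<open>i \<ge> r + 2\<close> lands in the lower half, where \<open>\<psi>\<close> vanishes; from
  \<open>r + 1\<close> it would land at 0, about which nothing is known.\<close>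

lemma coefficients_two_terms:
  assumes "2 \<le> n" and small: "\<And>t. 1 \<le> t \<Longrightarrow> t \<le> (n - 2) div 2 \<Longrightarrow> \<psi> t = 0"
  obtains r where "(n - 2) div 2 < r" "r \<le> n - 1"
    "\<And>i. 1 \<le> i \<Longrightarrow> i < n \<Longrightarrow> i \<noteq> r \<Longrightarrow> i \<noteq> r + 1 \<Longrightarrow> \<psi> i = 0"
proof (cases "\<exists>r. 1 \<le> r \<and> r < n \<and> \<psi> r \<noteq> 0")
  case False
  \<comment> \<open>All coefficients vanish, so any admissible \<open>r\<close> would do.\<close>
  then show ?thesis using assms(1) by (intro that[of "n - 1"]) auto
next
  case True
  then obtain r where r: "1 \<le> r" "r < n" "\<psi> r \<noteq> 0"
    and least: "\<And>s. s < r \<Longrightarrow> \<not> (1 \<le> s \<and> s < n \<and> \<psi> s \<noteq> 0)"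
    using exists_least_iff[of "\<lambda>r. 1 \<le> r \<and> r < n \<and> \<psi> r \<noteq> 0"] by blast
  have large: "(n - 2) div 2 < r" using small r by (meson not_le)
  show ?thesis
  proof (rule that[OF large])
    show "r \<le> n - 1" using r by simp
    fix i assume i: "1 \<le> i" "i < n" "i \<noteq> r" "i \<noteq> r + 1"
    show "\<psi> i = 0"
    proof (cases "i < r")
      case True
      then show ?thesis using least i by blast
    next
      case False
      then have *: "r + 2 \<le> i" using i by simp
      then have "\<psi> i = \<psi> (i - (r + 1))"
        using periodic[of "i - (r + 1)" r] r i by simp
      also have "i - (r + 1) \<le> (n - 2) div 2" using large i by linarith
      then have "\<psi> (i - (r + 1)) = 0" using small * by simp
      finally show ?thesis .
    qed
  qed
qed

end

text \<open>For \<open>n = 3\<close> and \<open>n = 4\<close> the average identity does not tie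
  \<open>\<psi> 2\<close> to \<open>\<psi> 1\<close>, hence their exclusion in (a). In (c)
  \<open>t\<close> must be the least index: if \<open>\<psi> 2 \<noteq> 0\<close>, then also
  \<open>\<psi> 5 \<noteq> 0\<close> for large \<open>n\<close>, but residues modulo 6 would miss
  \<open>e 2\<close>.\<close>

theorem theorem3p18:
  fixes scale :: "complex \<Rightarrow> 'a::ab_group_add \<Rightarrow> 'a" (infixr \<open>*s\<close> 75)
    and prd :: "'a \<Rightarrow> 'a \<Rightarrow> 'a"
    and e :: "nat \<Rightarrow> 'a"
    and n :: nat
    and \<psi> :: "nat \<Rightarrow> complex"
    and P :: "'a \<Rightarrow> 'a"
  assumes "2 \<le> n"
    and "null_filiform_algebra scale prd e n"
    and "homogeneous_operator_degree_1 scale e n \<psi> P"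
    and "average_operator scale prd P"
  shows "(n \<noteq> 3 \<and> n \<noteq> 4 \<and> \<psi> 1 * \<psi> 2 \<noteq> 0 \<longrightarrow>
            (\<forall>i\<in>{1..n}. P (e i) = \<psi> 1 *s e (i + 1)))
       \<and> (\<psi> 1 \<noteq> 0 \<and> \<psi> 2 = 0 \<longrightarrow>
            (\<forall>i\<in>{1..n}. P (e i) = (if odd i then \<psi> 1 *s e (i + 1) else 0)))
       \<and> (\<psi> 1 = 0 \<and> (\<exists>t. 2 \<le> t \<and> t \<le> (n - 2) div 2 \<and> \<psi> t \<noteq> 0) \<longrightarrow>
            (\<exists>t. 2 \<le> t \<and> t \<le> (n - 2) div 2 \<and> \<psi> t \<noteq> 0 \<and>
                 (\<forall>s. 1 \<le> s \<and> s < t \<longrightarrow> \<psi> s = 0) \<and>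
                 (\<forall>i\<in>{1..n}. P (e i) = (if [i + 1 = 0] (mod (t + 1)) then \<psi> t *s e (i + 1) else 0))))
       \<and> ((\<forall>t. 1 \<le> t \<and> t \<le> (n - 2) div 2 \<longrightarrow> \<psi> t = 0) \<longrightarrow>
            (\<exists>r. (n - 2) div 2 < r \<and> r \<le> n - 1 \<and>
                 (\<forall>i\<in>{1..n}. P (e i) = (if i = r then \<psi> r *s e (r + 1)
                                       else if i = r + 1 then \<psi> (r + 1) *s e (r + 2)
                                       else 0))))"
proof -
  interpret null_filiform_algebra scale prd e n by fact
  note n = assms(1) and Pe = P_e'[OF assms(3,4,1)] and \<psi>n = average_last_coefficient[OF assms(3,4,1)]
  note per = average_coefficient[OF assms(3,4)]
  \<comment> \<open>For \<open>i = n\<close> any \<open>c\<close> is right because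
    \<open>e (n + 1) = 0\<close>, so only indices below \<open>n\<close> matter.\<close>
  have P_eqI: "P (e i) = c *s e (i + 1)" if "i \<in> {1..n}" "i < n \<Longrightarrow> \<psi> i = c" for i c
    using that Pe e_beyond[of "n + 1"] by (cases "i = n") auto
  have P_eq0: "P (e i) = 0" if "i \<in> {1..n}" "i < n \<Longrightarrow> \<psi> i = 0" for i
    using P_eqI[OF that] by simp
  have "\<forall>i\<in>{1..n}. P (e i) = \<psi> 1 *s e (i + 1)" if "n \<noteq> 3" "n \<noteq> 4" "\<psi> 1 * \<psi> 2 \<noteq> 0"
  proof -
    \<comment> \<open>For \<open>n = 2\<close> the coefficient \<open>\<psi> 2\<close> is the last
      one, hence zero.\<close>
    have "n \<noteq> 2" using that \<psi>n by auto
    then have "5 \<le> n" using that n by simp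
    then have "\<psi> i = \<psi> 1" if "i \<in> {1..n}" "i < n" for i
      using coefficients_constant[of n \<psi> i, OF per] \<open>\<psi> 1 * \<psi> 2 \<noteq> 0\<close> that by simp
    then show ?thesis using P_eqI by blast
  qed
  moreover have "\<forall>i\<in>{1..n}. P (e i) = (if odd i then \<psi> 1 *s e (i + 1) else 0)"
    if "\<psi> 1 \<noteq> 0" "\<psi> 2 = 0"
  proof
    fix i assume i: "i \<in> {1..n}"
    have "\<psi> i = (if odd i then \<psi> 1 else 0)" if "i < n"
      using coefficients_parity[of n \<psi> i, OF per] \<open>\<psi> 1 \<noteq> 0\<close> \<open>\<psi> 2 = 0\<close> i that by simp
    then show "P (e i) = (if odd i then \<psi> 1 *s e (i + 1) else 0)"
      using P_eqI[OF i] P_eq0[OF i] by simp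
  qed
  moreover have "\<exists>t. 2 \<le> t \<and> t \<le> (n - 2) div 2 \<and> \<psi> t \<noteq> 0 \<and>
      (\<forall>s. 1 \<le> s \<and> s < t \<longrightarrow> \<psi> s = 0) \<and>
      (\<forall>i\<in>{1..n}. P (e i) = (if [i + 1 = 0] (mod (t + 1)) then \<psi> t *s e (i + 1) else 0))"
    if "\<psi> 1 = 0" and ex: "\<exists>t. 2 \<le> t \<and> t \<le> (n - 2) div 2 \<and> \<psi> t \<noteq> 0"
  proof -
    obtain t where t: "2 \<le> t" "t \<le> (n - 2) div 2" "\<psi> t \<noteq> 0"
      and least: "\<And>s. s < t \<Longrightarrow> \<not> (2 \<le> s \<and> s \<le> (n - 2) div 2 \<and> \<psi> s \<noteq> 0)"
      using ex exists_least_iff[of "\<lambda>t. 2 \<le> t \<and> t \<le> (n - 2) div 2 \<and> \<psi> t \<noteq> 0"] by blast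
    \<comment> \<open>Minimality was taken among indices from 2 on; \<open>s = 1\<close> is covered
      by \<open>\<psi> 1 = 0\<close>.\<close>
    have zero: "\<psi> s = 0" if "1 \<le> s" "s < t" for s
      using that least[of s] t \<open>\<psi> 1 = 0\<close> by (cases "s = 1") auto
    have "2 * t + 2 \<le> n" using t by linarith
    then have "\<psi> i = (if (t + 1) dvd (i + 1) then \<psi> t else 0)" if "1 \<le> i" "i < n" for i
      using coefficients_mod[of n \<psi> t i, OF per] t zero that by blast
    then have "P (e i) = (if [i + 1 = 0] (mod (t + 1)) then \<psi> t *s e (i + 1) else 0)"
      if "i \<in> {1..n}" for i
      using P_eqI[OF that, of "\<psi> t"] P_eq0[OF that] that unfolding cong_0_iff by auto
    then show ?thesis using t zero by blast
  qed
  moreover have "\<exists>r. (n - 2) div 2 < r \<and> r \<le> n - 1 \<and>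
      (\<forall>i\<in>{1..n}. P (e i) = (if i = r then \<psi> r *s e (r + 1)
                            else if i = r + 1 then \<psi> (r + 1) *s e (r + 2)
                            else 0))"
    if small: "\<forall>t. 1 \<le> t \<and> t \<le> (n - 2) div 2 \<longrightarrow> \<psi> t = 0"
  proof -
    obtain r where "(n - 2) div 2 < r" "r \<le> n - 1"
      and r: "\<And>i. 1 \<le> i \<Longrightarrow> i < n \<Longrightarrow> i \<noteq> r \<Longrightarrow> i \<noteq> r + 1 \<Longrightarrow> \<psi> i = 0"
      using coefficients_two_terms[of n \<psi>, OF per n] small by blast
    moreover have "P (e i) = (if i = r then \<psi> r *s e (r + 1)
        else if i = r + 1 then \<psi> (r + 1) *s e (r + 2) else 0)" if "i \<in> {1..n}" for i
      using r[of i] Pe[OF that] P_eq0[OF that] that by auto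
    ultimately show ?thesis by blast
  qed
  ultimately show ?thesis by blast
qed

end
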